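(* The Kolmogorov semantics $\mu^{\mathsf K}$, the Gentzen semantics $\mu^{\mathsf{Gen}}$ and the Glivenko semantics $\mu^{\mathsf{Gli}}$ are double negation semantics for any class of (bounded) hoops.
   Context: A pocrim is a structure $\mathbf{P}=(P;0,+,\rightarrow)$ such that, writing $x\ge y$ for $x\rightarrow y=0$: $(P;0,+)$ is a commutative monoid; $\ge$ is a partial order on $P$; $x\ge y$ implies $x+z\ge y+z$; $x\ge 0$ for all $x$; and $x+y\ge z$ iff $x\ge y\rightarrow z$. A hoop is a pocrim satisfying $x+(x\rightarrow y)=y+(y\rightarrow x)$. A pocrim is bounded if it has an element $1$ with $x+1=1$ for all $x$; then $\neg x=x\rightarrow 1$ and $\delta(x)=\neg\neg x$. A bounded pocrim is involutive if $\delta(x)=x$ for all $x$. Homomorphisms of bounded pocrims preserve $0,1,+,\rightarrow$. All pocrims and hoops here are bounded. $\mathcal{L}$ is the set of formulas built from a countable set of variables $\mathrm{Var}=\{V_1,V_2,\ldots\}$ and the constant $1$ using binary connectives $\otimes$ and $\multimap$. A semantics is a family $\mu$ of functions $\mu_{\mathbf P}$, one for each bounded pocrim $\mathbf{P}$, mapping each assignment $\alpha:\mathrm{Var}\to P$ to a function $\mu_{\mathbf P}(\alpha):\mathcal{L}\to P$, that is natural: for every homomorphism of bounded pocrims $h:\mathbf{P}\to\mathbf{Q}$, $\mu_{\mathbf Q}(h\circ\alpha)=h\circ\mu_{\mathbf P}(\alpha)$. The standard semantics $\mu^{\mathsf S}$ is given by $\mu^{\mathsf S}_{\mathbf P}(\alpha)(V_i)=\alpha(V_i)$,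 $\mu^{\mathsf S}_{\mathbf P}(\alpha)(1)=1$, and interpreting $\otimes$ as $+$ and $\multimap$ as $\rightarrow$. The Kolmogorov semantics is given recursively by $\mu^{\mathsf K}_{\mathbf P}(\alpha)(V_i)=\delta(\alpha(V_i))$, $\mu^{\mathsf K}_{\mathbf P}(\alpha)(1)=1$, $\mu^{\mathsf K}_{\mathbf P}(\alpha)(A\otimes B)=\delta(\mu^{\mathsf K}_{\mathbf P}(\alpha)(A)+\mu^{\mathsf K}_{\mathbf P}(\alpha)(B))$, $\mu^{\mathsf K}_{\mathbf P}(\alpha)(A\multimap B)=\delta(\mu^{\mathsf K}_{\mathbf P}(\alpha)(A)\rightarrow\mu^{\mathsf K}_{\mathbf P}(\alpha)(B))$. The Gentzen semantics is $\mu^{\mathsf{Gen}}_{\mathbf P}(\alpha)=\mu^{\mathsf S}_{\mathbf P}(\delta\circ\alpha)$. The Glivenko semantics is $\mu^{\mathsf{Gli}}_{\mathbf P}(\alpha)=\delta\circ\mu^{\mathsf S}_{\mathbf P}(\alpha)$. Write $\delta^{\mathcal L}$ for the family of maps $\delta^{\mathcal L}_{\mathbf P}$, one for each bounded pocrim $\mathbf{P}$, sending a function $f:\mathcal{L}\to P$ to $\delta\circ f$. For a class $\mathcal{C}$ of bounded pocrims, a semantics $\mu$ is a double negation semantics for $\mathcal{C}$ if: (DNS1) if $\mathbf{P}\in\mathcal{C}$ is involutive then $\mu_{\mathbf P}=\mu^{\mathsf S}_{\mathbf P}$; (DNS2) for every formula $A$, if $\mu^{\mathsf S}_{\mathbf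 P}(\alpha)(A)=0$ for every involutive $\mathbf{P}\in\mathcal{C}$ and every $\alpha:\mathrm{Var}\to P$, then $\mu_{\mathbf P}(\alpha)(A)=0$ for every $\mathbf{P}\in\mathcal{C}$ and every $\alpha:\mathrm{Var}\to P$; (DNS3) $\delta^{\mathcal L}\circ\mu=\mu$, i.e. $\delta\circ\mu_{\mathbf P}(\alpha)=\mu_{\mathbf P}(\alpha)$ for every bounded pocrim $\mathbf{P}$ and every $\alpha:\mathrm{Var}\to P$.
   Formalization: The class of hoops is assumed to contain, up to isomorphism, the involutive core (fixed points of δ) of each member, as (DNS2) fails otherwise; for the Gentzen semantics (DNS3) is claimed for all bounded hoops only, since it fails in some bounded pocrims. *)

theory Defs
  imports Main
begin

record 'a pocrim =
  pcarrier :: "'a set"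
  pzero :: 'a
  pone :: 'a
  pplus :: "'a \<Rightarrow> 'a \<Rightarrow> 'a"
  pimp :: "'a \<Rightarrow> 'a \<Rightarrow> 'a"

definition pge :: "'a pocrim \<Rightarrow> 'a \<Rightarrow> 'a \<Rightarrow> bool" where
  "pge P x y \<longleftrightarrow> pimp P x y = pzero P"

locale pocrim =
  fixes P :: "'a pocrim"
  assumes zero_closed: "pzero P \<in> pcarrier P"
    and plus_closed: "\<lbrakk>x \<in> pcarrier P; y \<in> pcarrier P\<rbrakk> \<Longrightarrow> pplus P x y \<in> pcarrier P"
    and imp_closed: "\<lbrakk>x \<in> pcarrier P; y \<in> pcarrier P\<rbrakk> \<Longrightarrow> pimp P x y \<in> pcarrier P"
    and plus_assoc: "\<lbrakk>x \<in> pcarrier P; y \<in> pcarrier P; z \<in> pcarrier P\<rbrakk>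
          \<Longrightarrow> pplus P (pplus P x y) z = pplus P x (pplus P y z)"
    and plus_comm: "\<lbrakk>x \<in> pcarrier P; y \<in> pcarrier P\<rbrakk> \<Longrightarrow> pplus P x y = pplus P y x"
    and plus_zero: "x \<in> pcarrier P \<Longrightarrow> pplus P x (pzero P) = x"
    and ge_refl: "x \<in> pcarrier P \<Longrightarrow> pge P x x"
    and ge_antisym: "\<lbrakk>x \<in> pcarrier P; y \<in> pcarrier P; pge P x y; pge P y x\<rbrakk> \<Longrightarrow> x = y"
    and ge_trans: "\<lbrakk>x \<in> pcarrier P; y \<in> pcarrier P; z \<in> pcarrier P; pge P x y; pge P y z\<rbrakk>
          \<Longrightarrow> pge P x z"
    and plus_mono: "\<lbrakk>x \<in> pcarrier P; y \<in> pcarrier P; z \<in> pcarrier P; pge P x y\<rbrakk>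
          \<Longrightarrow> pge P (pplus P x z) (pplus P y z)"
    and ge_zero: "x \<in> pcarrier P \<Longrightarrow> pge P x (pzero P)"
    and residuation: "\<lbrakk>x \<in> pcarrier P; y \<in> pcarrier P; z \<in> pcarrier P\<rbrakk>
          \<Longrightarrow> pge P (pplus P x y) z \<longleftrightarrow> pge P x (pimp P y z)"

locale bounded_pocrim = pocrim P for P :: "'a pocrim" +
  assumes one_closed: "pone P \<in> pcarrier P"
    and plus_one: "x \<in> pcarrier P \<Longrightarrow> pplus P x (pone P) = pone P"

locale bounded_hoop = bounded_pocrim P for P :: "'a pocrim" +
  assumes plus_imp_commute: "\<lbrakk>x \<in> pcarrier P; y \<in> pcarrier P\<rbrakk>
          \<Longrightarrow> pplus P x (pimp P x y) = pplus P y (pimp P y x)"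

definition pneg :: "'a pocrim \<Rightarrow> 'a \<Rightarrow> 'a" where
  "pneg P x = pimp P x (pone P)"

definition dneg :: "'a pocrim \<Rightarrow> 'a \<Rightarrow> 'a" where
  "dneg P x = pneg P (pneg P x)"

definition involutive :: "'a pocrim \<Rightarrow> bool" where
  "involutive P \<longleftrightarrow> (\<forall>x\<in>pcarrier P. dneg P x = x)"

definition pocrim_hom :: "'a pocrim \<Rightarrow> 'b pocrim \<Rightarrow> ('a \<Rightarrow> 'b) \<Rightarrow> bool" where
  "pocrim_hom P Q h \<longleftrightarrow>
     h ` pcarrier P \<subseteq> pcarrier Q \<and> h (pzero P) = pzero Q \<and> h (pone P) = pone Q \<and>
     (\<forall>x\<in>pcarrier P. \<forall>y\<in>pcarrier P.
        h (pplus P x y) = pplus Q (h x) (h y) \<and> h (pimp P x y) = pimp Q (h x) (h y))"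

definition pocrim_isomorphic :: "'a pocrim \<Rightarrow> 'b pocrim \<Rightarrow> bool" where
  "pocrim_isomorphic P Q \<longleftrightarrow>
     (\<exists>h. pocrim_hom P Q h \<and> bij_betw h (pcarrier P) (pcarrier Q))"

datatype formula = Var nat | One | Tensor formula formula | Lolli formula formula

type_synonym 'a sem = "'a pocrim \<Rightarrow> (nat \<Rightarrow> 'a) \<Rightarrow> formula \<Rightarrow> 'a"

definition assignment :: "'a pocrim \<Rightarrow> (nat \<Rightarrow> 'a) \<Rightarrow> bool" where
  "assignment P \<alpha> \<longleftrightarrow> range \<alpha> \<subseteq> pcarrier P"

text \<open>A family of functions indexed by all bounded pocrims is rendered by its members on the bounded
  pocrims with carrier inside a type. The two arguments of \<open>natural\<close> are the parts of such a family
  over two possibly different types.\<close>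

definition natural :: "'a sem \<Rightarrow> 'b sem \<Rightarrow> bool" where
  "natural \<mu> \<nu> \<longleftrightarrow>
     (\<forall>P Q h \<alpha> A. bounded_pocrim P \<longrightarrow> bounded_pocrim Q \<longrightarrow> pocrim_hom P Q h \<longrightarrow> assignment P \<alpha> \<longrightarrow>
        \<nu> Q (h \<circ> \<alpha>) A = h (\<mu> P \<alpha> A))"

definition semantics :: "'a sem \<Rightarrow> bool" where
  "semantics \<mu> \<longleftrightarrow>
     (\<forall>P \<alpha> A. bounded_pocrim P \<longrightarrow> assignment P \<alpha> \<longrightarrow> \<mu> P \<alpha> A \<in> pcarrier P) \<and> natural \<mu> \<mu>"

primrec standard :: "'a pocrim \<Rightarrow> (nat \<Rightarrow> 'a) \<Rightarrow> formula \<Rightarrow> 'a" where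
  "standard P \<alpha> (Var i) = \<alpha> i"
| "standard P \<alpha> One = pone P"
| "standard P \<alpha> (Tensor A B) = pplus P (standard P \<alpha> A) (standard P \<alpha> B)"
| "standard P \<alpha> (Lolli A B) = pimp P (standard P \<alpha> A) (standard P \<alpha> B)"

primrec kolmogorov :: "'a pocrim \<Rightarrow> (nat \<Rightarrow> 'a) \<Rightarrow> formula \<Rightarrow> 'a" where
  "kolmogorov P \<alpha> (Var i) = dneg P (\<alpha> i)"
| "kolmogorov P \<alpha> One = pone P"
| "kolmogorov P \<alpha> (Tensor A B) = dneg P (pplus P (kolmogorov P \<alpha> A) (kolmogorov P \<alpha> B))"
| "kolmogorov P \<alpha> (Lolli A B) = dneg P (pimp P (kolmogorov P \<alpha> A) (kolmogorov P \<alpha> B))"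

definition gentzen :: "'a pocrim \<Rightarrow> (nat \<Rightarrow> 'a) \<Rightarrow> formula \<Rightarrow> 'a" where
  "gentzen P \<alpha> = standard P (dneg P \<circ> \<alpha>)"

definition glivenko :: "'a pocrim \<Rightarrow> (nat \<Rightarrow> 'a) \<Rightarrow> formula \<Rightarrow> 'a" where
  "glivenko P \<alpha> = dneg P \<circ> standard P \<alpha>"

definition DNS1 :: "'a pocrim set \<Rightarrow> 'a sem \<Rightarrow> bool" where
  "DNS1 C \<mu> \<longleftrightarrow>
     (\<forall>P\<in>C. involutive P \<longrightarrow> (\<forall>\<alpha>. assignment P \<alpha> \<longrightarrow> \<mu> P \<alpha> = standard P \<alpha>))"

definition DNS2 :: "'a pocrim set \<Rightarrow> 'a sem \<Rightarrow> bool" where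
  "DNS2 C \<mu> \<longleftrightarrow>
     (\<forall>A. (\<forall>P\<in>C. involutive P \<longrightarrow> (\<forall>\<alpha>. assignment P \<alpha> \<longrightarrow> standard P \<alpha> A = pzero P)) \<longrightarrow>
          (\<forall>P\<in>C. \<forall>\<alpha>. assignment P \<alpha> \<longrightarrow> \<mu> P \<alpha> A = pzero P))"

definition DNS3 :: "'a pocrim set \<Rightarrow> 'a sem \<Rightarrow> bool" where
  "DNS3 D \<mu> \<longleftrightarrow> (\<forall>P\<in>D. \<forall>\<alpha>. assignment P \<alpha> \<longrightarrow> dneg P \<circ> \<mu> P \<alpha> = \<mu> P \<alpha>)"

text \<open>\<open>D\<close> is the ambient class over which the equation of the third condition is required.
  The definition of a double negation semantics takes all bounded pocrims for \<open>D\<close>. The Gentzen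
  semantics violates the equation in some bounded pocrims that are not hoops, such as the chain
  \<open>0 < p < q < r < 1\<close> where every sum of two or more of \<open>p\<close>, \<open>q\<close> is \<open>q\<close> and \<open>r\<close> plus any nonzero
  element is \<open>1\<close>: there \<open>dneg p = p\<close>, but \<open>dneg (p + p) = dneg q = p\<close>.\<close>

definition double_negation_semantics_over :: "'a pocrim set \<Rightarrow> 'a pocrim set \<Rightarrow> 'a sem \<Rightarrow> bool" where
  "double_negation_semantics_over D C \<mu> \<longleftrightarrow> semantics \<mu> \<and> DNS1 C \<mu> \<and> DNS2 C \<mu> \<and> DNS3 D \<mu>"

definition double_negation_semantics :: "'a pocrim set \<Rightarrow> 'a sem \<Rightarrow> bool" where
  "double_negation_semantics C \<mu> \<longleftrightarrow> double_negation_semantics_over {P. bounded_pocrim P} C \<mu>"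

text \<open>The operations are those induced on the fixed points of \<open>dneg\<close> in an arbitrary bounded pocrim,
  where a sum of fixed points need not be a fixed point.\<close>

definition involutive_core :: "'a pocrim \<Rightarrow> 'a pocrim" where
  "involutive_core P =
     \<lparr>pcarrier = {x \<in> pcarrier P. dneg P x = x}, pzero = pzero P, pone = pone P,
      pplus = (\<lambda>x y. dneg P (pplus P x y)), pimp = pimp P\<rparr>"

text \<open>Without this closure property the second condition fails: if \<open>C\<close> consists of a single
  non-involutive hoop, its premise is vacuous, while the formula \<open>One\<close> does not evaluate to zero.\<close>

definition closed_under_involutive_cores :: "'a pocrim set \<Rightarrow> bool" where
  "closed_under_involutive_cores C \<longleftrightarrow>
     (\<forall>P\<in>C. \<exists>Q\<in>C. pocrim_isomorphic Q (involutive_core P))"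

end

theory Submission
  imports Defs
begin

text \<open>
  In a bounded hoop \<open>x \<ge> y\<close> implies \<open>x = y + (y \<rightarrow> x)\<close>. This makes \<open>d = \<delta>(x) \<rightarrow> x\<close> dense, that is
  \<open>\<not>d = 1\<close>: from \<open>x \<ge> d\<close> and \<open>\<not>x \<ge> d\<close> one obtains \<open>\<not>d \<ge> \<delta>(x)\<close>, so
  \<open>\<not>d = \<delta>(x) + (\<delta>(x) \<rightarrow> \<not>d) = \<delta>(x) + \<not>(\<delta>(x) + d) = \<delta>(x) + \<not>x = 1\<close>. Density gives
  \<open>\<delta>(x \<rightarrow> y) = \<delta>(x) \<rightarrow> \<delta>(y)\<close>. If \<open>u\<close> is dense, \<open>r = \<delta>(r)\<close> and \<open>r \<ge> u\<close>, then
  \<open>r = u + (u \<rightarrow> r) = u + r\<close>; applied to \<open>r = \<delta>(p + q)\<close> and \<open>u = r \<rightarrow> p + q\<close> with fixed points \<open>p\<close>,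
  \<open>q\<close>, where \<open>r + r \<ge> p + q\<close>, this shows that the fixed points of \<open>\<delta>\<close> are closed under addition.
  So \<open>\<delta>\<close> is a homomorphism onto the involutive core, the three semantics coincide on hoops, and each
  is the standard semantics of the involutive core at \<open>\<delta> \<circ> \<alpha>\<close>.
\<close>

section \<open>Pocrims\<close>

context pocrim
begin

abbreviation plus (infixl "\<oplus>" 65) where "x \<oplus> y \<equiv> pplus P x y"
abbreviation imp (infixr "\<rightarrow>" 60) where "x \<rightarrow> y \<equiv> pimp P x y"
abbreviation ge (infix "\<succeq>" 50) where "x \<succeq> y \<equiv> pge P x y"
abbreviation carr ("\<K>") where "\<K> \<equiv> pcarrier P"

lemmas closed [simp] = zero_closed plus_closed imp_closed

lemma zero_plus: "x \<in> \<K> \<Longrightarrow> pzero P \<oplus> x = x"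
  by (metis plus_comm plus_zero zero_closed)

lemma plus_ge_right: "\<lbrakk>x \<in> \<K>; y \<in> \<K>\<rbrakk> \<Longrightarrow> x \<oplus> y \<succeq> y"
  using plus_mono[of x "pzero P" y] by (simp add: ge_zero zero_plus)

lemma plus_ge_left: "\<lbrakk>x \<in> \<K>; y \<in> \<K>\<rbrakk> \<Longrightarrow> x \<oplus> y \<succeq> x"
  by (metis plus_comm plus_ge_right)

lemma plus_mono2:
  assumes "x \<in> \<K>" "y \<in> \<K>" "z \<in> \<K>" "w \<in> \<K>" "x \<succeq> y" "z \<succeq> w"
  shows "x \<oplus> z \<succeq> y \<oplus> w"
proof -
  have "x \<oplus> z \<succeq> y \<oplus> z"
    using assms by (simp add: plus_mono)
  moreover have "y \<oplus> z \<succeq> y \<oplus> w"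
    using plus_mono[of z w y] assms by (simp add: plus_comm)
  ultimately show ?thesis
    using ge_trans assms by (meson plus_closed)
qed

text \<open>Modus ponens. The order runs opposite to provability: zero is truth and one is
  falsity.\<close>

lemma imp_plus_ge: "\<lbrakk>x \<in> \<K>; y \<in> \<K>\<rbrakk> \<Longrightarrow> (x \<rightarrow> y) \<oplus> x \<succeq> y"
  by (simp add: residuation ge_refl)

lemma ge_imp_right: "\<lbrakk>x \<in> \<K>; y \<in> \<K>\<rbrakk> \<Longrightarrow> y \<succeq> (x \<rightarrow> y)"
  by (simp add: residuation[symmetric] plus_ge_left)

lemma zero_imp: "x \<in> \<K> \<Longrightarrow> pzero P \<rightarrow> x = x"
  by (metis ge_antisym ge_imp_right imp_closed imp_plus_ge plus_zero zero_closed)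

lemma imp_curry:
  assumes "x \<in> \<K>" "y \<in> \<K>" "z \<in> \<K>"
  shows "(x \<oplus> y) \<rightarrow> z = x \<rightarrow> y \<rightarrow> z"
proof -
  have "w \<succeq> (x \<oplus> y \<rightarrow> z) \<longleftrightarrow> w \<succeq> (x \<rightarrow> y \<rightarrow> z)" if "w \<in> \<K>" for w
    using assms that by (simp add: residuation[symmetric] plus_assoc)
  then show ?thesis
    using assms by (metis ge_antisym ge_refl imp_closed plus_closed)
qed

lemma imp_exchange:
  "\<lbrakk>x \<in> \<K>; y \<in> \<K>; z \<in> \<K>\<rbrakk> \<Longrightarrow> x \<rightarrow> y \<rightarrow> z = y \<rightarrow> x \<rightarrow> z"
  by (metis imp_curry plus_comm)

lemma imp_trans:
  assumes "x \<in> \<K>" "y \<in> \<K>" "z \<in> \<K>"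
  shows "(x \<rightarrow> y) \<oplus> (y \<rightarrow> z) \<succeq> (x \<rightarrow> z)"
proof -
  have "(x \<rightarrow> y) \<oplus> (y \<rightarrow> z) \<oplus> x = (y \<rightarrow> z) \<oplus> ((x \<rightarrow> y) \<oplus> x)"
    using assms by (metis imp_closed plus_assoc plus_comm)
  moreover have "\<dots> \<succeq> (y \<rightarrow> z) \<oplus> y"
    using assms by (intro plus_mono2) (auto simp: imp_plus_ge ge_refl)
  moreover have "(y \<rightarrow> z) \<oplus> y \<succeq> z"
    using assms by (simp add: imp_plus_ge)
  ultimately have "(x \<rightarrow> y) \<oplus> (y \<rightarrow> z) \<oplus> x \<succeq> z"
    using assms ge_trans by (metis imp_closed plus_closed)
  then show ?thesis
    using assms by (simp add: residuation)
qed

lemma imp_antimono: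
  assumes "x \<in> \<K>" "y \<in> \<K>" "z \<in> \<K>" "x \<succeq> y"
  shows "(y \<rightarrow> z) \<succeq> (x \<rightarrow> z)"
  using imp_trans[of x y z] assms zero_plus unfolding pge_def by auto

end

section \<open>Double negation in bounded pocrims\<close>

context bounded_pocrim
begin

abbreviation one ("\<one>") where "\<one> \<equiv> pone P"
abbreviation neg ("\<sim>_" [80] 80) where "\<sim>x \<equiv> pneg P x"
abbreviation dn ("\<delta>") where "\<delta> x \<equiv> dneg P x"

lemma neg_closed [simp]: "x \<in> \<K> \<Longrightarrow> \<sim>x \<in> \<K>"
  by (simp add: pneg_def one_closed)

lemma dneg_closed [simp]: "x \<in> \<K> \<Longrightarrow> \<delta> x \<in> \<K>"
  by (simp add: dneg_def)

lemma one_ge: "x \<in> \<K> \<Longrightarrow> \<one> \<succeq> x"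
  by (metis one_closed plus_ge_left plus_one)

lemma ge_one_eq: "\<lbrakk>x \<in> \<K>; x \<succeq> \<one>\<rbrakk> \<Longrightarrow> x = \<one>"
  by (simp add: ge_antisym one_closed one_ge)

lemma plus_neg: "x \<in> \<K> \<Longrightarrow> x \<oplus> \<sim>x = \<one>"
  by (metis ge_one_eq imp_plus_ge neg_closed one_closed plus_closed plus_comm pneg_def)

lemma neg_antimono: "\<lbrakk>x \<in> \<K>; y \<in> \<K>; x \<succeq> y\<rbrakk> \<Longrightarrow> \<sim>y \<succeq> \<sim>x"
  by (simp add: pneg_def imp_antimono one_closed)

lemma neg_plus: "\<lbrakk>x \<in> \<K>; y \<in> \<K>\<rbrakk> \<Longrightarrow> \<sim>(x \<oplus> y) = x \<rightarrow> \<sim>y"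
  by (simp add: pneg_def imp_curry one_closed)

lemma imp_neg_exchange: "\<lbrakk>x \<in> \<K>; y \<in> \<K>\<rbrakk> \<Longrightarrow> x \<rightarrow> \<sim>y = y \<rightarrow> \<sim>x"
  by (simp add: pneg_def imp_exchange one_closed)

lemma ge_neg_iff: "\<lbrakk>x \<in> \<K>; y \<in> \<K>\<rbrakk> \<Longrightarrow> x \<succeq> \<sim>y \<longleftrightarrow> x \<oplus> y = \<one>"
  by (metis ge_one_eq ge_refl one_closed plus_closed pneg_def residuation)

lemma ge_dneg: "x \<in> \<K> \<Longrightarrow> x \<succeq> \<delta> x"
  by (simp add: dneg_def ge_neg_iff plus_neg)

text \<open>One inequality is \<open>ge_dneg\<close> under the antitone negation, the other is
  \<open>ge_dneg\<close> at \<open>\<sim>x\<close>.\<close>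

lemma neg_dneg: "x \<in> \<K> \<Longrightarrow> \<sim>(\<delta> x) = \<sim>x"
  by (metis dneg_closed dneg_def ge_antisym ge_dneg neg_antimono neg_closed)

lemma dneg_neg: "x \<in> \<K> \<Longrightarrow> \<delta> (\<sim>x) = \<sim>x"
  using neg_dneg by (simp add: dneg_def)

lemma dneg_idem: "x \<in> \<K> \<Longrightarrow> \<delta> (\<delta> x) = \<delta> x"
  by (simp add: dneg_def dneg_neg[unfolded dneg_def])

lemma dneg_mono: "\<lbrakk>x \<in> \<K>; y \<in> \<K>; x \<succeq> y\<rbrakk> \<Longrightarrow> \<delta> x \<succeq> \<delta> y"
  by (simp add: dneg_def neg_antimono)

lemma neg_zero: "\<sim>(pzero P) = \<one>"
  by (simp add: pneg_def zero_imp one_closed)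

lemma neg_one: "\<sim>\<one> = pzero P"
  using ge_refl[OF one_closed] by (simp add: pneg_def pge_def)

lemma dneg_one: "\<delta> \<one> = \<one>"
  by (simp add: dneg_def neg_zero neg_one)

lemma imp_dneg: "\<lbrakk>x \<in> \<K>; y \<in> \<K>\<rbrakk> \<Longrightarrow> x \<rightarrow> \<delta> y = \<sim>(x \<oplus> \<sim>y)"
  by (simp add: dneg_def neg_plus)

text \<open>Since \<open>\<delta> y\<close> is a negation, exchange makes the premise enter only
  through its own negation, which \<open>neg_dneg\<close> computes.\<close>

lemma dneg_imp_dneg: "\<lbrakk>x \<in> \<K>; y \<in> \<K>\<rbrakk> \<Longrightarrow> \<delta> x \<rightarrow> \<delta> y = x \<rightarrow> \<delta> y"
  by (metis dneg_closed dneg_def imp_neg_exchange neg_closed neg_dneg)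

lemma dneg_imp_fixed: "\<lbrakk>x \<in> \<K>; y \<in> \<K>\<rbrakk> \<Longrightarrow> \<delta> (x \<rightarrow> \<delta> y) = x \<rightarrow> \<delta> y"
  by (simp add: imp_dneg dneg_neg)

text \<open>By \<open>neg_plus\<close> and exchange, the negation of a sum sees each summand only
  through that summand's negation.\<close>

lemma dneg_plus_dneg: "\<lbrakk>x \<in> \<K>; y \<in> \<K>\<rbrakk> \<Longrightarrow> \<delta> (\<delta> x \<oplus> \<delta> y) = \<delta> (x \<oplus> y)"
  by (metis dneg_closed dneg_def imp_neg_exchange neg_dneg neg_plus)

text \<open>The half of \<open>dneg_imp\<close> that holds in every bounded pocrim:
  \<open>x \<rightarrow> \<delta> y\<close> lies below \<open>x \<rightarrow> y\<close> and is a
  fixed point.\<close>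

lemma dneg_imp_ge:
  assumes "x \<in> \<K>" "y \<in> \<K>"
  shows "\<delta> (x \<rightarrow> y) \<succeq> (\<delta> x \<rightarrow> \<delta> y)"
proof -
  have "(x \<rightarrow> y) \<oplus> x \<succeq> \<delta> y"
    using assms by (meson dneg_closed ge_dneg ge_trans imp_closed imp_plus_ge plus_closed)
  then have "\<delta> (x \<rightarrow> y) \<succeq> \<delta> (x \<rightarrow> \<delta> y)"
    using assms by (intro dneg_mono) (auto simp: residuation)
  then show ?thesis
    using assms by (simp add: dneg_imp_fixed dneg_imp_dneg)
qed

end

section \<open>Double negation in bounded hoops\<close>

context bounded_hoop
begin

text \<open>The form in which the hoop law is used: any smaller element can be split off as a
  summand.\<close>

lemma plus_imp_of_ge: "\<lbrakk>x \<in> \<K>; y \<in> \<K>; x \<succeq> y\<rbrakk> \<Longrightarrow> y \<oplus> (y \<rightarrow> x) = x"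
  by (metis pge_def plus_imp_commute plus_zero)

lemma neg_dneg_imp_self:
  assumes x: "x \<in> \<K>"
  shows "\<sim>(\<delta> x \<rightarrow> x) = \<one>"
proof -
  define d where "d = \<delta> x \<rightarrow> x"
  have d: "d \<in> \<K>"
    using x by (simp add: d_def)
  have "x \<succeq> d"
    using x by (simp add: d_def ge_imp_right)
  then have "\<sim>d \<succeq> \<sim>x"
    using x d by (simp add: neg_antimono)
  \<comment> \<open>Splitting \<open>\<sim>x\<close> off \<open>\<sim>d\<close> leaves
    \<open>\<sim>x \<rightarrow> \<sim>d\<close>, which exchange turns into
    \<open>d \<rightarrow> \<delta> x\<close>.\<close>
  then have nd: "\<sim>d = \<sim>x \<oplus> (d \<rightarrow> \<delta> x)"
    using x d plus_imp_of_ge[of "\<sim>d" "\<sim>x"]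
    by (simp add: dneg_def imp_neg_exchange)
  have "\<sim>x \<oplus> \<delta> x \<succeq> x"
    using x by (simp add: dneg_def plus_neg one_ge)
  then have "\<sim>x \<succeq> d"
    using x by (simp add: d_def residuation)
  then have "\<sim>x = d \<oplus> (d \<rightarrow> \<sim>x)"
    using x d by (simp add: plus_imp_of_ge)
  \<comment> \<open>With \<open>d\<close> split off \<open>\<sim>x\<close> in turn, the modus ponens
    pair for \<open>\<delta> x\<close> becomes a summand of \<open>\<sim>d\<close>.\<close>
  then have "\<sim>d = (d \<rightarrow> \<sim>x) \<oplus> ((d \<rightarrow> \<delta> x) \<oplus> d)"
    using nd x d by (metis dneg_closed imp_closed neg_closed plus_assoc plus_comm)
  moreover have "\<dots> \<succeq> (d \<rightarrow> \<delta> x) \<oplus> d"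
    using x d by (simp add: plus_ge_right)
  moreover have "(d \<rightarrow> \<delta> x) \<oplus> d \<succeq> \<delta> x"
    using x d by (simp add: imp_plus_ge)
  ultimately have "\<sim>d \<succeq> \<delta> x"
    using x d ge_trans by (metis dneg_closed imp_closed neg_closed plus_closed)
  then have "\<sim>d = \<delta> x \<oplus> (\<delta> x \<rightarrow> \<sim>d)"
    using x d by (simp add: plus_imp_of_ge)
  also have "\<dots> = \<delta> x \<oplus> \<sim>(\<delta> x \<oplus> d)"
    using x d by (simp add: neg_plus)
  also have "\<delta> x \<oplus> d = x"
    using x by (simp add: d_def plus_imp_of_ge ge_dneg)
  also have "\<delta> x \<oplus> \<sim>x = \<one>"
    using x by (metis dneg_closed neg_dneg plus_neg)
  finally show ?thesis
    by (simp add: d_def)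
qed

lemma dneg_imp:
  assumes "x \<in> \<K>" "y \<in> \<K>"
  shows "\<delta> (x \<rightarrow> y) = \<delta> x \<rightarrow> \<delta> y"
proof (rule ge_antisym)
  define n where "n = \<sim>(x \<rightarrow> y)"
  have n: "n \<in> \<K>"
    using assms by (simp add: n_def)
  have "(x \<rightarrow> \<delta> y) \<oplus> (\<delta> y \<rightarrow> y) \<succeq> (x \<rightarrow> y)"
    using assms by (simp add: imp_trans)
  then have "(x \<rightarrow> \<delta> y) \<oplus> (\<delta> y \<rightarrow> y) \<oplus> n \<succeq> (x \<rightarrow> y) \<oplus> n"
    using assms n by (simp add: plus_mono)
  then have "(x \<rightarrow> \<delta> y) \<oplus> (\<delta> y \<rightarrow> y) \<oplus> n = \<one>"
    using assms n ge_one_eq by (simp add: n_def plus_neg)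
  then have "(x \<rightarrow> \<delta> y) \<oplus> n \<oplus> (\<delta> y \<rightarrow> y) = \<one>"
    using assms n by (metis dneg_closed imp_closed plus_assoc plus_comm)
  then have "(x \<rightarrow> \<delta> y) \<oplus> n \<succeq> \<sim>(\<delta> y \<rightarrow> y)"
    using assms n by (simp add: ge_neg_iff)
  then have "(x \<rightarrow> \<delta> y) \<oplus> n = \<one>"
    using assms n by (simp add: neg_dneg_imp_self ge_one_eq)
  then show "(\<delta> x \<rightarrow> \<delta> y) \<succeq> \<delta> (x \<rightarrow> y)"
    using assms n by (simp add: dneg_imp_dneg dneg_def[of P "x \<rightarrow> y"] ge_neg_iff n_def)
qed (use assms in \<open>auto simp: dneg_imp_ge\<close>)

lemma plus_dense:
  assumes "u \<in> \<K>" "r \<in> \<K>" "\<sim>u = \<one>" "\<delta> r = r" "r \<succeq> u"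
  shows "u \<oplus> r = r"
proof -
  \<comment> \<open>As \<open>r\<close> is a fixed point, the premise may be replaced by
    \<open>\<delta> u\<close>, which is \<open>\<sim>\<one>\<close> and hence zero.\<close>
  have "u \<rightarrow> r = \<delta> u \<rightarrow> \<delta> r"
    using assms(1,2,4) by (metis dneg_imp_dneg)
  also have "\<dots> = r"
    using assms by (simp add: dneg_def[of P u] neg_one zero_imp)
  finally show ?thesis
    using plus_imp_of_ge[of r u] assms by simp
qed

lemma dneg_plus:
  assumes x: "x \<in> \<K>" and y: "y \<in> \<K>"
  shows "\<delta> (x \<oplus> y) = \<delta> x \<oplus> \<delta> y"
proof -
  define s where "s = \<delta> x \<oplus> \<delta> y"
  define u where "u = \<delta> s \<rightarrow> s"
  have s: "s \<in> \<K>"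
    using x y by (simp add: s_def)
  have "s \<succeq> \<delta> x" "s \<succeq> \<delta> y"
    using x y by (auto simp: s_def plus_ge_left plus_ge_right)
  then have "\<delta> s \<succeq> \<delta> x" "\<delta> s \<succeq> \<delta> y"
    using dneg_mono[of s "\<delta> x"] dneg_mono[of s "\<delta> y"] x y s by (auto simp: dneg_idem)
  then have "\<delta> s \<oplus> \<delta> s \<succeq> s"
    using x y s unfolding s_def by (intro plus_mono2) auto
  then have "\<delta> s \<succeq> u"
    using s by (simp add: u_def residuation)
  then have "u \<oplus> \<delta> s = \<delta> s"
    using s by (intro plus_dense) (auto simp: u_def dneg_idem neg_dneg_imp_self)
  \<comment> \<open>The same sum computed again: density absorbs \<open>u\<close> into
    \<open>\<delta> s\<close>, while the hoop law restores \<open>s\<close>.\<close>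
  moreover have "\<delta> s \<oplus> u = s"
    using s by (simp add: u_def plus_imp_of_ge ge_dneg)
  ultimately have "\<delta> s = s"
    using s by (metis dneg_closed imp_closed plus_comm u_def)
  then show ?thesis
    using x y by (simp add: s_def dneg_plus_dneg)
qed

end

section \<open>The three semantics\<close>

lemma assignmentD: "assignment P \<alpha> \<Longrightarrow> \<alpha> i \<in> pcarrier P"
  by (auto simp: assignment_def)

context bounded_pocrim
begin

lemma standard_closed: "assignment P \<alpha> \<Longrightarrow> standard P \<alpha> A \<in> \<K>"
  by (induction A) (auto simp: assignmentD one_closed)

lemma kolmogorov_closed: "assignment P \<alpha> \<Longrightarrow> kolmogorov P \<alpha> A \<in> \<K>"
  by (induction A) (auto simp: assignmentD one_closed)

lemma assignment_dneg: "assignment P \<alpha> \<Longrightarrow> assignment P (dneg P \<circ> \<alpha>)"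
  using assignmentD[of P \<alpha>] by (auto simp: assignment_def)

lemma gentzen_closed: "assignment P \<alpha> \<Longrightarrow> gentzen P \<alpha> A \<in> \<K>"
  by (simp add: gentzen_def assignment_dneg standard_closed)

lemma glivenko_closed: "assignment P \<alpha> \<Longrightarrow> glivenko P \<alpha> A \<in> \<K>"
  by (simp add: glivenko_def standard_closed)

text \<open>No induction is involved: each clause other than \<open>One\<close> has an outermost
  \<open>\<delta>\<close>.\<close>

lemma dneg_kolmogorov: "assignment P \<alpha> \<Longrightarrow> \<delta> (kolmogorov P \<alpha> A) = kolmogorov P \<alpha> A"
  by (cases A) (auto simp: assignmentD kolmogorov_closed dneg_idem dneg_one)

lemma dneg_glivenko: "assignment P \<alpha> \<Longrightarrow> \<delta> (glivenko P \<alpha> A) = glivenko P \<alpha> A"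
  by (simp add: glivenko_def standard_closed dneg_idem)

text \<open>The core's sum already applies \<open>\<delta>\<close>; its implication does not, but
  implications between fixed points are fixed.\<close>

lemma standard_core_eq_kolmogorov:
  assumes "assignment P \<alpha>"
  shows "standard (involutive_core P) (dneg P \<circ> \<alpha>) A = kolmogorov P \<alpha> A"
proof (induction A)
  case (Lolli A B)
  have "pimp (involutive_core P) = pimp P"
    by (simp add: involutive_core_def)
  then show ?case
    using Lolli assms dneg_imp_fixed[of "kolmogorov P \<alpha> A" "kolmogorov P \<alpha> B"]
    by (simp add: kolmogorov_closed dneg_kolmogorov)
qed (simp_all add: involutive_core_def)

end

section \<open>Coincidence of the three semantics on hoops\<close>

context bounded_hoop
begin

lemma glivenko_eq_kolmogorov: "assignment P \<alpha> \<Longrightarrow> glivenko P \<alpha> = kolmogorov P \<alpha>"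
proof
  fix A
  assume \<alpha>: "assignment P \<alpha>"
  have "\<delta> (standard P \<alpha> A) = kolmogorov P \<alpha> A"
  proof (induction A)
    case (Tensor A B)
    then show ?case
      using dneg_plus_dneg[of "standard P \<alpha> A" "standard P \<alpha> B"]
      by (simp add: standard_closed \<alpha>)
  next
    case (Lolli A B)
    then show ?case
      using dneg_imp[of "standard P \<alpha> A" "standard P \<alpha> B"]
        dneg_idem[of "standard P \<alpha> A \<rightarrow> standard P \<alpha> B"]
      by (simp add: standard_closed \<alpha>)
  qed (auto simp: dneg_one)
  then show "glivenko P \<alpha> A = kolmogorov P \<alpha> A"
    by (simp add: glivenko_def)
qed

text \<open>The Gentzen recursion applies \<open>\<delta>\<close> at variables only, so its tensor
  case calls for \<open>dneg_plus\<close> where \<open>dneg_plus_dneg\<close> served the Glivenko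
  semantics.\<close>

lemma gentzen_eq_glivenko: "assignment P \<alpha> \<Longrightarrow> gentzen P \<alpha> = glivenko P \<alpha>"
proof
  fix A
  assume \<alpha>: "assignment P \<alpha>"
  have "standard P (dneg P \<circ> \<alpha>) A = \<delta> (standard P \<alpha> A)"
    by (induction A) (auto simp: dneg_one dneg_plus dneg_imp standard_closed \<alpha>)
  then show "gentzen P \<alpha> A = glivenko P \<alpha> A"
    by (simp add: gentzen_def glivenko_def)
qed

end

section \<open>Naturality\<close>

lemma standard_hom:
  assumes "bounded_pocrim P" "pocrim_hom P Q h" "assignment P \<alpha>"
  shows "standard Q (h \<circ> \<alpha>) A = h (standard P \<alpha> A)"
  using assms(2) bounded_pocrim.standard_closed[OF assms(1,3)]
  by (induction A) (auto simp: pocrim_hom_def)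

text \<open>Here and in \<open>standard_hom\<close> the target is any record, so that
  \<open>DNS2_kolmogorov\<close> can take the involutive core for it.\<close>

lemma dneg_hom:
  assumes "bounded_pocrim P" "pocrim_hom P Q h" "x \<in> pcarrier P"
  shows "dneg Q (h x) = h (dneg P x)"
proof -
  interpret bounded_pocrim P by fact
  show ?thesis
    using assms(2,3) one_closed by (simp add: pocrim_hom_def dneg_def pneg_def)
qed

lemma dneg_comp_hom:
  assumes "bounded_pocrim P" "pocrim_hom P Q h" "assignment P \<alpha>"
  shows "dneg Q \<circ> (h \<circ> \<alpha>) = h \<circ> (dneg P \<circ> \<alpha>)"
  using assms(3) by (simp add: fun_eq_iff assignmentD dneg_hom[OF assms(1,2)])

lemma kolmogorov_hom:
  assumes P: "bounded_pocrim P" and h: "pocrim_hom P Q h" and \<alpha>: "assignment P \<alpha>"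
  shows "kolmogorov Q (h \<circ> \<alpha>) A = h (kolmogorov P \<alpha> A)"
proof -
  interpret bounded_pocrim P by fact
  note [simp] = kolmogorov_closed[OF \<alpha>] dneg_hom[OF P h, symmetric]
  show ?thesis
  proof (induction A)
    case (Tensor A B)
    then show ?case
      using h by (simp add: pocrim_hom_def)
  next
    case (Lolli A B)
    then show ?case
      using h by (simp add: pocrim_hom_def)
  qed (use h \<alpha> in \<open>simp_all add: assignmentD pocrim_hom_def\<close>)
qed

text \<open>The two occurrences have independent types, which covers homomorphisms within one type
  and across two.\<close>

lemma natural_kolmogorov: "natural kolmogorov kolmogorov"
  by (simp add: natural_def kolmogorov_hom)

lemma natural_gentzen: "natural gentzen gentzen"
  by (simp add: natural_def gentzen_def dneg_comp_hom standard_hom bounded_pocrim.assignment_dneg)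

lemma natural_glivenko: "natural glivenko glivenko"
  by (simp add: natural_def glivenko_def standard_hom dneg_hom bounded_pocrim.standard_closed)

section \<open>DNS1 and DNS2 for the Kolmogorov semantics\<close>

lemma DNS1_kolmogorov:
  assumes "\<forall>P\<in>C. bounded_pocrim P"
  shows "DNS1 C kolmogorov"
  unfolding DNS1_def
proof (intro ballI impI allI ext)
  fix P \<alpha> A
  assume "P \<in> C" and inv: "involutive P" and \<alpha>: "assignment P \<alpha>"
  then interpret bounded_pocrim P
    using assms by blast
  show "kolmogorov P \<alpha> A = standard P \<alpha> A"
    using inv \<alpha>
    by (induction A) (auto simp: involutive_def assignmentD standard_closed)
qed

text \<open>The Kolmogorov value is a standard value in the core, and the core has an isomorphic
  copy \<open>Q\<close> in \<open>C\<close>, where the premise applies.\<close>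

lemma DNS2_kolmogorov:
  fixes C :: "'a pocrim set"
  assumes C: "\<forall>P\<in>C. bounded_pocrim P" and cores: "closed_under_involutive_cores C"
  shows "DNS2 C kolmogorov"
  unfolding DNS2_def
proof (intro ballI impI allI)
  fix A and P :: "'a pocrim" and \<alpha>
  assume valid: "\<forall>P\<in>C. involutive P \<longrightarrow> (\<forall>\<alpha>. assignment P \<alpha> \<longrightarrow> standard P \<alpha> A = pzero P)"
    and P: "P \<in> C" and \<alpha>: "assignment P \<alpha>"
  interpret bounded_pocrim P
    using C P by blast
  let ?R = "involutive_core P"
  obtain Q h where Q: "Q \<in> C" and h: "pocrim_hom Q ?R h"
    and bij: "bij_betw h (pcarrier Q) (pcarrier ?R)"
    using cores P unfolding closed_under_involutive_cores_def pocrim_isomorphic_def by blast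
  interpret Q: bounded_pocrim Q
    using C Q by blast
  have "dneg Q x = x" if x: "x \<in> pcarrier Q" for x
  proof -
    have "h x \<in> pcarrier ?R"
      using bij x by (auto simp: bij_betw_def)
    \<comment> \<open>Negation in the core is that of \<open>P\<close>, and the carrier of the core
      consists of fixed points.\<close>
    then have "dneg ?R (h x) = h x"
      by (simp add: involutive_core_def dneg_def pneg_def)
    then have "h (dneg Q x) = h x"
      using dneg_hom[OF Q.bounded_pocrim_axioms h x] by simp
    then show ?thesis
      using bij x by (meson Q.dneg_closed bij_betw_def inj_onD)
  qed
  then have inv: "involutive Q"
    by (simp add: involutive_def)
  \<comment> \<open>The values of \<open>dneg P \<circ> \<alpha>\<close> lie in the core, so they
    can be pulled back along the bijection \<open>h\<close>.\<close>
  define \<beta> where "\<beta> = inv_into (pcarrier Q) h \<circ> (dneg P \<circ> \<alpha>)"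
  have im: "(dneg P \<circ> \<alpha>) i \<in> h ` pcarrier Q" for i
    using bij \<alpha> by (auto simp: bij_betw_def involutive_core_def assignmentD dneg_idem)
  then have \<beta>: "assignment Q \<beta>"
    unfolding assignment_def \<beta>_def by (auto intro!: inv_into_into)
  have "h \<circ> \<beta> = dneg P \<circ> \<alpha>"
    using im by (auto simp: \<beta>_def fun_eq_iff f_inv_into_f)
  then have "kolmogorov P \<alpha> A = h (standard Q \<beta> A)"
    using standard_core_eq_kolmogorov[OF \<alpha>] standard_hom[OF Q.bounded_pocrim_axioms h \<beta>]
    by simp
  then show "kolmogorov P \<alpha> A = pzero P"
    using valid Q inv \<beta> h by (simp add: pocrim_hom_def involutive_core_def)
qed

theorem theorem5p2p1:
  fixes C :: "'a pocrim set"
  assumes "\<forall>P\<in>C. bounded_hoop P"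
    and "closed_under_involutive_cores C"
  shows "double_negation_semantics C kolmogorov
    \<and> double_negation_semantics_over {P. bounded_hoop P} C gentzen
    \<and> double_negation_semantics C glivenko
    \<and> natural (kolmogorov :: 'a sem) (kolmogorov :: 'b sem)
    \<and> natural (gentzen :: 'a sem) (gentzen :: 'b sem)
    \<and> natural (glivenko :: 'a sem) (glivenko :: 'b sem)"
proof -
  have C: "\<forall>P\<in>C. bounded_pocrim P"
    using assms(1) bounded_hoop.axioms(1) by blast
  have eq: "gentzen P \<alpha> = kolmogorov P \<alpha>" "glivenko P \<alpha> = kolmogorov P \<alpha>"
    if "bounded_hoop P" "assignment P \<alpha>" for P :: "'a pocrim" and \<alpha>
    using that by (simp_all add: bounded_hoop.gentzen_eq_glivenko bounded_hoop.glivenko_eq_kolmogorov)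
  have sem: "semantics (kolmogorov :: 'a sem)" "semantics (gentzen :: 'a sem)"
    "semantics (glivenko :: 'a sem)"
    by (simp_all add: semantics_def natural_kolmogorov natural_gentzen natural_glivenko
        bounded_pocrim.kolmogorov_closed bounded_pocrim.gentzen_closed
        bounded_pocrim.glivenko_closed)
  have dns1: "DNS1 C kolmogorov"
    using C by (rule DNS1_kolmogorov)
  \<comment> \<open>DNS1 and DNS2 only concern members of \<open>C\<close>, all hoops, so
    \<open>eq\<close> transfers them from the Kolmogorov semantics.\<close>
  moreover have "DNS1 C gentzen" "DNS1 C glivenko"
    using dns1 assms(1) eq by (simp_all add: DNS1_def)
  moreover have dns2: "DNS2 C kolmogorov"
    using C assms(2) by (rule DNS2_kolmogorov)
  moreover have "DNS2 C gentzen" "DNS2 C glivenko"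
    using dns2 assms(1) eq by (simp_all add: DNS2_def)
  moreover have "DNS3 {P. bounded_pocrim P} (kolmogorov :: 'a sem)"
    "DNS3 {P. bounded_pocrim P} (glivenko :: 'a sem)"
    by (auto simp: DNS3_def fun_eq_iff bounded_pocrim.dneg_kolmogorov bounded_pocrim.dneg_glivenko)
  moreover have "DNS3 {P. bounded_hoop P} (gentzen :: 'a sem)"
    using bounded_hoop.axioms(1)
    by (simp add: DNS3_def fun_eq_iff eq) (blast intro: bounded_pocrim.dneg_kolmogorov)
  ultimately show ?thesis
    using sem natural_kolmogorov natural_gentzen natural_glivenko
    unfolding double_negation_semantics_def double_negation_semantics_over_def by blast
qed

end
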